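(* Let $\lambda_0\ge 1$ be an integer, $\rho>1$ a real number, and $\lambda_k=\lceil\lambda_{k-1}\rho\rceil$ for $k\ge 1$. Let $\mathcal{L}^*(\hat\lambda,\rho)$ be the loss function of this restart strategy, and let $$\mathcal{L}^*_{\mathrm{low}}(\hat\lambda,\rho)=\frac{1}{\rho-1}\left(\hat\lambda-\lambda_0-\frac{\ln(\hat\lambda/\lambda_0)}{\ln(\rho)}-1\right).$$ Then $\mathcal{L}^*_{\mathrm{low}}(\hat\lambda,\rho)$ is a lower bound of $\mathcal{L}^*(\hat\lambda,\rho)$, i.e. $\mathcal{L}^*(\hat\lambda,\rho)\ge\mathcal{L}^*_{\mathrm{low}}(\hat\lambda,\rho)$ for all integers $\hat\lambda\ge\lambda_0$.
   Context: For a restart strategy $(\lambda_0,\lambda_1,\lambda_2,\ldots)$ (an unbounded sequence of natural numbers) and an integer $\hat\lambda\ge\lambda_0$, let $\hat k(\hat\lambda)=\min\{k\ge 0:\lambda_k\ge\hat\lambda\}$. The loss function is $\mathcal{L}(\hat\lambda)=\sum_{k=0}^{\hat k(\hat\lambda)}\lambda_k-\hat\lambda$; it is denoted $\mathcal{L}^*(\hat\lambda,\rho)$ for the strategy $\lambda_k=\lceil\lambda_{k-1}\rho\rceil$. *)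

theory Defs
  imports Complex_Main
begin

definition hit_index :: "(nat \<Rightarrow> nat) \<Rightarrow> nat \<Rightarrow> nat" where
  "hit_index l lhat = (LEAST k. lhat \<le> l k)"

definition loss :: "(nat \<Rightarrow> nat) \<Rightarrow> nat \<Rightarrow> int" where
  "loss l lhat = (\<Sum>k = 0..hit_index l lhat. int (l k)) - int lhat"

text \<open>The ceiling is nonnegative whenever the growth factor is, so the conversion by \<open>nat\<close>
  does not truncate.\<close>

primrec geom_strategy :: "nat \<Rightarrow> real \<Rightarrow> nat \<Rightarrow> nat" where
  "geom_strategy l0 \<rho> 0 = l0"
| "geom_strategy l0 \<rho> (Suc k) = nat \<lceil>real (geom_strategy l0 \<rho> k) * \<rho>\<rceil>"

definition geom_loss :: "nat \<Rightarrow> nat \<Rightarrow> real \<Rightarrow> int" where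
  "geom_loss l0 lhat \<rho> = loss (geom_strategy l0 \<rho>) lhat"

definition geom_loss_low :: "nat \<Rightarrow> nat \<Rightarrow> real \<Rightarrow> real" where
  "geom_loss_low l0 lhat \<rho> =
     1 / (\<rho> - 1) * (real lhat - real l0 - ln (real lhat / real l0) / ln \<rho> - 1)"

text \<open>The sequence is unbounded, so the \<open>LEAST\<close> in \<open>hit_index\<close> is attained for it.\<close>

lemma geom_strategy_ge:
  assumes "1 \<le> l0" and "1 < \<rho>"
  shows "l0 + k \<le> geom_strategy l0 \<rho> k"
proof (induction k)
  case 0
  show ?case by simp
next
  case (Suc k)
  let ?x = "geom_strategy l0 \<rho> k"
  have "0 < ?x" using Suc assms(1) by linarith
  then have "real ?x * 1 < real ?x * \<rho>" using assms(2) by (intro mult_strict_left_mono) auto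
  then have "int ?x < \<lceil>real ?x * \<rho>\<rceil>" by (simp add: less_ceiling_iff)
  then show ?case using Suc by simp
qed

lemma geom_strategy_unbounded:
  assumes "1 \<le> l0" and "1 < \<rho>"
  shows "\<exists>k. n \<le> geom_strategy l0 \<rho> k"
  using geom_strategy_ge[OF assms, of n] by (intro exI[of _ n]) linarith

end

theory Submission
  imports Defs
begin

text \<open>Let \<open>K\<close> be the hit index. Summing \<open>\<lambda>\<^sub>k\<^sub>+\<^sub>1 \<le> \<rho> \<lambda>\<^sub>k + 1\<close> over \<open>k < K\<close> telescopes to
  \<open>\<lambda>\<^sub>K - \<lambda>\<^sub>0 \<le> (\<rho> - 1) (\<lambda>\<^sub>0 + \<dots> + \<lambda>\<^sub>K\<^sub>-\<^sub>1) + K\<close>. Minimality of \<open>K\<close> and \<open>\<lambda>\<^sub>k \<ge> \<lambda>\<^sub>0 \<rho>\<^sup>k\<close>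
  bound \<open>K - 1\<close> by the logarithm of \<open>lhat / \<lambda>\<^sub>0\<close> to base \<open>\<rho>\<close>.\<close>

lemma geom_strategy_Suc_le:
  assumes "0 \<le> \<rho>"
  shows "real (geom_strategy l0 \<rho> (Suc k)) \<le> real (geom_strategy l0 \<rho> k) * \<rho> + 1"
proof -
  \<comment> \<open>Nonnegativity keeps \<open>nat\<close> from truncating, so rounding up adds less
    than 1.\<close>
  have "0 \<le> real (geom_strategy l0 \<rho> k) * \<rho>" using assms by simp
  then show ?thesis unfolding geom_strategy.simps(2) by linarith
qed

lemma geom_strategy_ge_power:
  assumes "0 \<le> \<rho>"
  shows "real l0 * \<rho> ^ k \<le> real (geom_strategy l0 \<rho> k)"
proof (induction k)
  case 0
  show ?case by simp
next
  case (Suc k)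
  have "real l0 * \<rho> ^ Suc k = (real l0 * \<rho> ^ k) * \<rho>" by simp
  also have "\<dots> \<le> real (geom_strategy l0 \<rho> k) * \<rho>"
    using Suc assms by (rule mult_right_mono)
  also have "\<dots> \<le> real (geom_strategy l0 \<rho> (Suc k))"
    by (simp add: real_nat_ceiling_ge)
  finally show ?case .
qed

lemma geom_strategy_le_sum:
  assumes "0 \<le> \<rho>"
  shows "real (geom_strategy l0 \<rho> K) - real l0
    \<le> (\<rho> - 1) * (\<Sum>k<K. real (geom_strategy l0 \<rho> k)) + real K"
proof (induction K)
  case 0
  show ?case by simp
next
  case (Suc K)
  then show ?case using geom_strategy_Suc_le[OF assms, of l0 K]
    by (simp add: algebra_simps del: geom_strategy.simps(2))
qed

lemma hit_index_geom_strategy_le: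
  assumes "1 \<le> l0" and "1 < \<rho>" and "l0 \<le> lhat"
  shows "real (hit_index (geom_strategy l0 \<rho>) lhat) \<le> ln (real lhat / real l0) / ln \<rho> + 1"
proof (cases "hit_index (geom_strategy l0 \<rho>) lhat")
  case 0
  \<comment> \<open>With no predecessor of index 0 to compare with, \<open>l0 \<le> lhat\<close>
    makes the logarithm nonnegative.\<close>
  then show ?thesis using assms by simp
next
  case (Suc m)
  \<comment> \<open>Minimality only constrains the index \<open>m\<close> before the hit, whence the
    \<open>+ 1\<close> in the bound.\<close>
  then have "geom_strategy l0 \<rho> m < lhat"
    unfolding hit_index_def using not_less_Least[of m "\<lambda>k. lhat \<le> geom_strategy l0 \<rho> k"] by simp
  then have "real l0 * \<rho> ^ m \<le> real lhat"
    using geom_strategy_ge_power[of \<rho> l0 m] assms(2) by linarith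
  then have "\<rho> ^ m \<le> real lhat / real l0"
    using assms(1) by (simp add: field_simps)
  then have "ln (\<rho> ^ m) \<le> ln (real lhat / real l0)"
    using assms by (intro ln_mono) auto
  then have "real m \<le> ln (real lhat / real l0) / ln \<rho>"
    using assms(2) by (simp add: ln_realpow pos_le_divide_eq)
  then show ?thesis using Suc by simp
qed

theorem corollary2:
  fixes l0 lhat :: nat and \<rho> :: real
  assumes "1 \<le> l0"
    and "1 < \<rho>"
    and "l0 \<le> lhat"
  shows "real_of_int (geom_loss l0 lhat \<rho>) \<ge> geom_loss_low l0 lhat \<rho>"
proof -
  let ?g = "geom_strategy l0 \<rho>"
  define K where "K = hit_index ?g lhat"
  define L where "L = real_of_int (geom_loss l0 lhat \<rho>)"
  have hit: "lhat \<le> ?g K"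
    unfolding K_def hit_index_def
    using geom_strategy_unbounded[OF assms(1,2), of lhat] by (rule LeastI_ex)
  have L: "L = (\<Sum>k<K. real (?g k)) + (real (?g K) - real lhat)"
    unfolding L_def geom_loss_def loss_def K_def[symmetric]
    by (simp add: atLeast0AtMost lessThan_Suc_atMost[symmetric])
  \<comment> \<open>The overshoot \<open>?g K - lhat\<close> is discarded twice: here as a part of
    \<open>L\<close>, and below when \<open>lhat\<close> replaces \<open>?g K\<close> in the
    telescoped bound.\<close>
  have "0 \<le> (\<rho> - 1) * (real (?g K) - real lhat)"
    using hit assms(2) by simp
  then have "real lhat - real l0 - real K \<le> (\<rho> - 1) * L"
    using geom_strategy_le_sum[of \<rho> l0 K] hit assms(2)
    unfolding L distrib_left by linarith
  then have "real lhat - real l0 - ln (real lhat / real l0) / ln \<rho> - 1 \<le> (\<rho> - 1) * L"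
    using hit_index_geom_strategy_le[OF assms] unfolding K_def by linarith
  then show ?thesis
    using assms(2) unfolding geom_loss_low_def L_def by (simp add: pos_divide_le_eq mult.commute)
qed

end
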